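(* Let $q$ be a prime power and let $\mathcal{E}$ be a $q$-ary Deza graph with parameters $(v,k,\lambda_1,\lambda_2;q)$ (where $\lambda_2\le\lambda_1$). Then at least one of the following holds: (1) $\mathcal{E}$ is a strongly regular $q$-ary graph; (2) $k$ is even and $(v,k,\lambda_1,\lambda_2;q)=(2k+1,k,2^a-1,1;2)$ for some integer $a$ with $2\le a\le k-1$ such that $(a-1)\mid k$ or $(a-1)\mid (k-2)$; (3) $vk$ is even and $(v,k,\lambda_1,\lambda_2;q)=(v,k,1,0;2)$ with $v\ge 2k+2$ and $k\ge 2$. Moreover, in cases (2) and (3), any two adjacent vertices $X\ne Y$ have precisely one common neighbor, i.e. $|(N_{\mathcal{E}}(X)\cap N_{\mathcal{E}}(Y))\setminus\{X,Y\}|=1$.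
   Context: A $q$-ary graph $\mathcal{E}$ on $\mathbb{F}_q^v$ is a pair $(V,E)$ where $V$ is the set of all $1$-dimensional subspaces of $\mathbb{F}_q^v$ (vertices) and $E$ is a set of $2$-dimensional subspaces of $\mathbb{F}_q^v$ (edges). Distinct vertices $X,Y$ are adjacent if $\langle X,Y\rangle\in E$. The neighborhood $N_{\mathcal{E}}(X)$ is the set consisting of $X$ and all vertices adjacent to $X$. $\mathcal{E}$ is $k$-regular if for every vertex $X$ the set $N_{\mathcal{E}}(X)$ is (the set of $1$-subspaces of) a $(k+1)$-dimensional subspace of $\mathbb{F}_q^v$. The common neighbors of distinct vertices $X,Y$ are the elements of $(N_{\mathcal{E}}(X)\cap N_{\mathcal{E}}(Y))\setminus\{X,Y\}$. A $k$-regular $q$-ary graph $\mathcal{E}$ on $\mathbb{F}_q^v$ is a $q$-ary Deza graph ($q$-Deza graph) with parameters $(v,k,b,a;q)$, where $0\le a\le b$ are integers, if $|(N_{\mathcal{E}}(X)\cap N_{\mathcal{E}}(Y))\setminus\{X,Y\}|\in\{a,b\}$ for all vertices $X\ne Y$. A $k$-regular $q$-ary graph is strongly regular if there are non-negative integers $\lambda,\mu$ such that for all vertices $X\neq Y$ the number $|(N_{\mathcal{E}}(X)\cap N_{\mathcal{E}}(Y))\setminus\{X,Y\}|$ equals $\lambda$ if $X,Y$ are adjacent and $\mu$ otherwise. *)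

theory Defs
  imports "HOL-Analysis.Cartesian_Space"
begin

text \<open>
  The field of order \<open>q\<close> is a finite field type \<open>'q\<close> with \<open>CARD('q) = q\<close>, and the space
  of dimension \<open>v\<close> over it is \<open>'q ^ 'n\<close> with \<open>CARD('n) = v\<close>; \<open>vec.subspace\<close>, \<open>vec.dim\<close>
  and \<open>vec.span\<close> are the notions over the field \<open>'q\<close>. Subspaces are sets of vectors.
\<close>

definition subspaces_of_dim :: "nat \<Rightarrow> ('q::field ^ 'n::finite) set set" where
  "subspaces_of_dim d = {U. vec.subspace U \<and> vec.dim U = d}"

abbreviation vertices :: "('q::field ^ 'n::finite) set set" where
  "vertices \<equiv> subspaces_of_dim 1"

text \<open>
  The vertex set of a \<open>q\<close>-ary graph is determined by the ambient space, so a graph is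
  given by its edge set \<open>E\<close>.
\<close>

definition qary_graph :: "('q::field ^ 'n::finite) set set \<Rightarrow> bool" where
  "qary_graph E \<longleftrightarrow> E \<subseteq> subspaces_of_dim 2"

definition adjacent ::
  "('q::field ^ 'n::finite) set set \<Rightarrow> ('q ^ 'n) set \<Rightarrow> ('q ^ 'n) set \<Rightarrow> bool" where
  "adjacent E X Y \<longleftrightarrow>
     X \<in> vertices \<and> Y \<in> vertices \<and> X \<noteq> Y \<and> vec.span (X \<union> Y) \<in> E"

definition neighborhood ::
  "('q::field ^ 'n::finite) set set \<Rightarrow> ('q ^ 'n) set \<Rightarrow> ('q ^ 'n) set set" where
  "neighborhood E X = insert X {Y. adjacent E X Y}"

definition regular_qary_graph :: "('q::field ^ 'n::finite) set set \<Rightarrow> nat \<Rightarrow> bool" where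
  "regular_qary_graph E k \<longleftrightarrow> qary_graph E \<and>
     (\<forall>X\<in>vertices. \<exists>U\<in>subspaces_of_dim (k + 1). neighborhood E X = {P \<in> vertices. P \<subseteq> U})"

definition common_neighbors ::
  "('q::field ^ 'n::finite) set set \<Rightarrow> ('q ^ 'n) set \<Rightarrow> ('q ^ 'n) set \<Rightarrow> ('q ^ 'n) set set"
  where
  "common_neighbors E X Y = (neighborhood E X \<inter> neighborhood E Y) - {X, Y}"

text \<open>The arguments after \<open>E\<close> are the parameters \<open>(v, k, b, a; q)\<close>, in this order.\<close>

definition q_deza_graph ::
  "('q::{field,finite} ^ 'n::finite) set set \<Rightarrow> nat \<Rightarrow> nat \<Rightarrow> nat \<Rightarrow> nat \<Rightarrow> nat \<Rightarrow> bool" where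
  "q_deza_graph E v k b a q \<longleftrightarrow>
     v = CARD('n) \<and> q = CARD('q) \<and> a \<le> b \<and> regular_qary_graph E k \<and>
     (\<forall>X\<in>vertices. \<forall>Y\<in>vertices. X \<noteq> Y \<longrightarrow> card (common_neighbors E X Y) \<in> {a, b})"

definition strongly_regular_qary_graph :: "('q::{field,finite} ^ 'n::finite) set set \<Rightarrow> bool"
  where
  "strongly_regular_qary_graph E \<longleftrightarrow>
     (\<exists>k. regular_qary_graph E k) \<and>
     (\<exists>l m. \<forall>X\<in>vertices. \<forall>Y\<in>vertices. X \<noteq> Y \<longrightarrow>
        card (common_neighbors E X Y) = (if adjacent E X Y then l else m))"

text \<open>
  In the next definition \<open>2 \<le> a\<close> and \<open>a \<le> k - 1\<close> force \<open>3 \<le> k\<close>, so that none of the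
  subtractions on \<^typ>\<open>nat\<close> is truncated.
\<close>

definition deza_params_mu1 :: "nat \<Rightarrow> nat \<Rightarrow> nat \<Rightarrow> nat \<Rightarrow> nat \<Rightarrow> bool" where
  "deza_params_mu1 v k l1 l2 q \<longleftrightarrow>
     even k \<and>
     (\<exists>a. 2 \<le> a \<and> a \<le> k - 1 \<and> (a - 1 dvd k \<or> a - 1 dvd k - 2) \<and>
        (v, k, l1, l2, q) = (2 * k + 1, k, 2 ^ a - 1, 1, 2))"

definition deza_params_mu0 :: "nat \<Rightarrow> nat \<Rightarrow> nat \<Rightarrow> nat \<Rightarrow> nat \<Rightarrow> bool" where
  "deza_params_mu0 v k l1 l2 q \<longleftrightarrow>
     even (v * k) \<and> (v, k, l1, l2, q) = (v, k, 1, 0, 2) \<and> v \<ge> 2 * k + 2 \<and> k \<ge> 2"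

end

theory Submission
  imports Defs
begin

text \<open>
  Write \<open>[d]\<close> for the number \<open>1 + q + \<dots> + q ^ (d - 1)\<close> of points of a \<open>d\<close>-dimensional space.  In a
  \<open>k\<close>-regular graph every vertex \<open>X\<close> has a neighbor space \<open>U\<^sub>X\<close> of dimension \<open>k + 1\<close>, and
  with \<open>d = dim (U\<^sub>X \<inter> U\<^sub>Y)\<close> the number of common neighbors of \<open>X\<close> and \<open>Y\<close> is \<open>[d] - 2\<close> if they
  are adjacent and \<open>[d]\<close> otherwise.

  Reduction to the binary field.  A number of both shapes satisfies \<open>[d] = [e] + 2\<close>, and reducing
  modulo \<open>q\<close> shows that this happens only for \<open>q = 2\<close>, \<open>d = 2\<close>, \<open>e = 1\<close>
  (\<open>gaussian_number_differ_by_two\<close>).  If a Deza graph is not strongly regular, then both of its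
  parameters occur among the adjacent pairs, or both occur among the nonadjacent pairs.  As pairs of
  the other kind exist as well, \<open>q = 2\<close> and their common neighbor number is always \<open>1\<close>.

  Both values on adjacent pairs.  This is impossible (\<open>not_two_adjacent_values\<close>).  Count the
  paths \<open>X, Z, Y\<close> with \<open>Y\<close> not adjacent to \<open>X\<close>: there is exactly one for each such \<open>Y\<close>, so the
  number \<open>A\<close> of neighbors of \<open>X\<close> with intersection dimension \<open>d > 2\<close> is the same for all \<open>X\<close>.
  If both dimensions occur, \<open>A\<close> lies strictly between \<open>0\<close> and the degree, but the resulting
  equation for \<open>A\<close> has no such solution.

  Both values on nonadjacent pairs (\<open>two_nonadjacent_values\<close>).  Now \<open>U\<^sub>X \<inter> U\<^sub>Y\<close> is a line for all
  adjacent pairs, and one parameter is \<open>1\<close>.  If the other one is \<open>0\<close>, two neighbor spaces meet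
  trivially and \<open>2 * k + 2 \<le> v\<close>.  If it is \<open>2 ^ a - 1\<close>, two neighbor spaces meet in a point, which
  gives \<open>2 * k + 1 \<le> v\<close>; counting paths of length two gives the opposite inequality, and also that
  \<open>2 ^ (a - 1) - 1\<close> divides \<open>(2 ^ k - 1) * (2 ^ (k - 2) - 1)\<close>.  A Mersenne number that divides a product
  of two Mersenne numbers has an exponent dividing one of the two exponents, because
  \<open>gcd (2 ^ m - 1) (2 ^ n - 1) = 2 ^ gcd m n - 1\<close>.  The parity conditions say that the number of
  edges is an integer.
\<close>

section \<open>Gaussian numbers\<close>

definition gaussian_number :: "nat \<Rightarrow> nat \<Rightarrow> nat" where
  "gaussian_number q d = (\<Sum>i<d. q ^ i)"

lemma gaussian_number_0 [simp]: "gaussian_number q 0 = 0"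
  by (simp add: gaussian_number_def)

lemma gaussian_number_Suc: "gaussian_number q (Suc d) = 1 + q * gaussian_number q d"
  unfolding gaussian_number_def sum.lessThan_Suc_shift by (simp add: sum_distrib_left)

lemma gaussian_number_mult: "0 < q \<Longrightarrow> gaussian_number q d * (q - 1) + 1 = q ^ d"
proof (induction d)
  case (Suc d)
  then obtain r where "q = Suc r"
    by (cases q) auto
  with Suc show ?case
    by (simp add: gaussian_number_def algebra_simps)
qed (simp add: gaussian_number_def)

lemma gaussian_number_binary: "gaussian_number 2 d = 2 ^ d - 1"
  using gaussian_number_mult[of 2 d] by simp

lemma gaussian_number_strict_mono:
  assumes "0 < q" "d < e" shows "gaussian_number q d < gaussian_number q e"
  unfolding gaussian_number_def
  using assms by (intro sum_strict_mono2[where b = d]) auto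

lemma gaussian_number_mono:
  assumes "0 < q" "d \<le> e" shows "gaussian_number q d \<le> gaussian_number q e"
  unfolding gaussian_number_def using assms by (intro sum_mono2) auto

lemma gaussian_number_inject:
  assumes "0 < q" shows "gaussian_number q d = gaussian_number q e \<longleftrightarrow> d = e"
  using gaussian_number_strict_mono[OF assms] by (metis less_irrefl linorder_neqE_nat)

lemma gaussian_number_1 [simp]: "gaussian_number q (Suc 0) = 1"
  by (simp add: gaussian_number_def)

text \<open>
  A Gaussian number with positive index is \<open>1\<close> modulo \<open>q\<close>, so \<open>q\<close> divides \<open>2\<close>; the index \<open>e = 0\<close> is
  excluded because \<open>2\<close> is not a Gaussian number.
  Removing the summand \<open>1\<close> and halving leaves two Gaussian numbers that differ by \<open>1\<close>, and parity finishes.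
\<close>

lemma gaussian_number_differ_by_two:
  assumes q: "2 \<le> q" and eq: "gaussian_number q d = gaussian_number q e + 2"
  shows "q = 2 \<and> d = 2 \<and> e = 1"
proof -
  obtain d' where d: "d = Suc d'"
    using eq by (cases d) auto
  have "e \<noteq> 0"
  proof
    assume "e = 0"
    then have "1 + q * gaussian_number q d' = 2"
      using eq unfolding d \<open>e = 0\<close> gaussian_number_Suc gaussian_number_0 by linarith
    then show False
      using q nat_mult_eq_1_iff[of q "gaussian_number q d'"] by linarith
  qed
  then obtain e' where e: "e = Suc e'"
    using not0_implies_Suc by blast
  have *: "q * gaussian_number q d' = q * gaussian_number q e' + 2"
    using eq unfolding d e gaussian_number_Suc by simp
  then have "q dvd 2"
    by (metis dvd_add_right_iff dvd_triv_left)
  then have q2: "q = 2"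
    using q by (simp add: dvd_imp_le le_antisym)
  have **: "gaussian_number 2 d' = gaussian_number 2 e' + 1"
    using * q2 by simp
  have "d' \<noteq> 0"
    using ** by (intro notI) simp
  then obtain d'' where d'': "d' = Suc d''"
    using not0_implies_Suc by blast
  have "e' = 0"
  proof (rule ccontr)
    assume "e' \<noteq> 0"
    then obtain e'' where "e' = Suc e''"
      using not0_implies_Suc by blast
    then have "2 * gaussian_number 2 d'' = 2 * gaussian_number 2 e'' + 1"
      using ** d'' by (simp add: gaussian_number_Suc)
    then show False
      by presburger
  qed
  moreover have "d'' = 0"
    using ** \<open>e' = 0\<close> d'' by (cases d'') (auto simp: gaussian_number_Suc)
  ultimately show ?thesis
    using q2 d e d'' by simp
qed

section \<open>Mersenne numbers and the counting equations\<close>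

lemma sum_two_valued:
  fixes h l :: int
  assumes "finite S" "\<And>x. x \<in> S \<Longrightarrow> f x = (if P x then h else l)"
  shows "sum f S = int (card S) * l + int (card {x \<in> S. P x}) * (h - l)"
proof -
  have "sum f S = (\<Sum>x\<in>S. l + (if P x then h - l else 0))"
    using assms(2) by (intro sum.cong) auto
  also have "\<dots> = int (card S) * l + int (card {x \<in> S. P x}) * (h - l)"
    using assms(1) by (simp add: sum.distrib flip: sum.inter_filter)
  finally show ?thesis .
qed

text \<open>
  The Euclidean algorithm on \<open>2 ^ m - 1\<close> and \<open>2 ^ n - 1\<close> mirrors the one on the exponents:
  \<open>2 ^ m - 1\<close> and \<open>2 ^ (m mod n) - 1\<close> differ by a multiple of \<open>(2 ^ n) ^ (m div n) - 1\<close>,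
  which \<open>2 ^ n - 1\<close> divides.
\<close>

lemma gcd_Mersenne: "gcd (2 ^ m - 1) (2 ^ n - 1 :: nat) = 2 ^ gcd m n - 1"
proof (induction m n rule: gcd_nat_induct)
  case (step m n)
  define x :: nat where "x = (2 ^ n) ^ (m div n)"
  have "2 ^ n - 1 dvd x - 1"
    using gaussian_number_mult[of "2 ^ n" "m div n"] unfolding x_def
    by (metis add_diff_cancel_right' dvd_triv_right zero_less_numeral zero_less_power)
  then obtain c where c: "x - 1 = (2 ^ n - 1) * c"
    by blast
  have "0 < x"
    by (simp add: x_def)
  have "(2::nat) ^ m = 2 ^ (m mod n) * x"
    unfolding x_def by (metis add.commute mult_div_mod_eq power_add power_mult)
  also have "\<dots> = 2 ^ (m mod n) * (x - 1) + 2 ^ (m mod n)"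
    using \<open>0 < x\<close> by (cases x) auto
  finally have "(2::nat) ^ m - 1 = 2 ^ (m mod n) * c * (2 ^ n - 1) + (2 ^ (m mod n) - 1)"
    unfolding c by (simp add: mult_ac)
  then have "gcd (2 ^ m - 1) (2 ^ n - 1) = gcd (2 ^ n - 1) (2 ^ (m mod n) - 1 :: nat)"
    by (simp only: gcd_add_mult gcd.commute)
  also have "\<dots> = 2 ^ gcd n (m mod n) - 1"
    by (rule step.IH)
  finally show ?case
    by (simp only: gcd_red_nat[of m n])
qed simp

text \<open>
  Otherwise \<open>gcd n k\<close> and \<open>gcd n j\<close> are proper divisors of \<open>n\<close>, hence at most \<open>n div 2\<close>.  But
  \<open>2 ^ n - 1\<close> divides the product of its greatest common divisors with the two factors, and this
  product of \<open>2 ^ gcd n k - 1\<close> and \<open>2 ^ gcd n j - 1\<close> is too small.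
\<close>

lemma dvd_exponent_of_Mersenne_dvd_mult:
  fixes n k j :: nat
  assumes n: "0 < n" and dvd: "2 ^ n - 1 dvd (2 ^ k - 1) * (2 ^ j - 1 :: nat)"
  shows "n dvd k \<or> n dvd j"
proof (rule ccontr)
  assume not: "\<not> (n dvd k \<or> n dvd j)"
  have small: "2 * gcd n i \<le> n" if "\<not> n dvd i" for i
  proof -
    obtain c where c: "n = gcd n i * c"
      by (meson dvdE gcd_dvd1)
    have "c \<noteq> 0"
      using n c by (intro notI) simp
    moreover have "c \<noteq> 1"
    proof
      assume "c = 1"
      then have "gcd n i = n" using c by simp
      then show False using that by (metis gcd_dvd2)
    qed
    ultimately have "gcd n i * 2 \<le> gcd n i * c"
      by (intro mult_le_mono2) simp
    then show ?thesis
      using c by linarith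
  qed
  define g where "g = gcd n k"
  define h where "h = gcd n j"
  have gh: "g + h \<le> n"
    using small[of k] small[of j] not unfolding g_def h_def by simp
  have pos: "0 < g" "0 < h"
    using n by (auto simp: g_def h_def)
  have "2 ^ n - 1 dvd gcd (2 ^ n - 1) (2 ^ k - 1) * gcd (2 ^ n - 1) (2 ^ j - 1 :: nat)"
  proof -
    obtain x y where "2 ^ n - 1 = x * y" "x dvd 2 ^ k - 1" "y dvd 2 ^ j - (1::nat)"
      using division_decomp[OF dvd] by blast
    then show ?thesis
      by (metis dvd_triv_left dvd_triv_right gcd_greatest mult_dvd_mono)
  qed
  then have "2 ^ n - 1 dvd (2 ^ g - 1) * (2 ^ h - 1 :: nat)"
    by (simp only: gcd_Mersenne g_def h_def)
  moreover have "(1::nat) < 2 ^ g" "(1::nat) < 2 ^ h"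
    using pos by (auto intro!: one_less_power simp del: One_nat_def)
  then have "0 < (2 ^ g - 1) * (2 ^ h - 1 :: nat)"
    by (simp del: One_nat_def)
  ultimately have "2 ^ n - 1 \<le> (2 ^ g - 1) * (2 ^ h - 1 :: nat)"
    by (rule dvd_imp_le)
  also have "\<dots> < 2 ^ (g + h) - 1"
  proof -
    have "2 ^ 1 \<le> (2::nat) ^ g" "2 ^ 1 \<le> (2::nat) ^ h"
      using pos by (intro power_increasing; simp)+
    then obtain x y :: nat where "2 ^ g = 2 + x" "2 ^ h = 2 + y"
      unfolding power_one_right by (metis le_Suc_ex)
    then show ?thesis by (simp add: power_add algebra_simps)
  qed
  also have "\<dots> \<le> 2 ^ n - (1::nat)"
    using gh by (intro diff_le_mono power_increasing) auto
  finally show False by simp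
qed

text \<open>
  With \<open>K = 2 ^ k\<close> the equation reads \<open>B * (2 ^ a - 2) = 4 * K^2 - 10 * K + 8 - 2 ^ v\<close>.  The
  right-hand side is negative for \<open>v \<ge> 2 * k + 2\<close>, and for \<open>v = 2 * k + 1\<close> it factors as
  \<open>2 * (K - 1) * (K - 4)\<close>, where \<open>K - 4 = 4 * (2 ^ (k - 2) - 1)\<close>.
\<close>

lemma nonadjacent_count_arith:
  fixes k v a B :: nat
  assumes a: "2 \<le> a" and B: "0 < B" and v: "2 * k + 1 \<le> v"
    and count: "(2 ^ (k + 1) - 2) * (2 ^ (k + 1) - 4)
      = (2 ^ v - 2 ^ (k + 1)) + int B * (2 ^ a - 2)"
  shows "v = 2 * k + 1" "2 < k" "2 ^ (a - 1) - 1 dvd (2 ^ k - 1) * (2 ^ (k - 2) - 1 :: nat)"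
proof -
  define K :: int where "K = 2 ^ k"
  have K1: "1 \<le> K" by (simp add: K_def)
  obtain a' where a': "a = Suc a'" "1 \<le> a'"
    using a by (cases a) auto
  have pos: "0 < (2::int) ^ a' - 1"
    using a' by (simp add: one_less_power)
  have eq: "2 * int B * (2 ^ a' - 1) = 4 * K * K - 10 * K + 8 - 2 ^ v"
    using count by (simp add: a' K_def algebra_simps)
  have eqpos: "0 < 2 * int B * (2 ^ a' - 1)"
    using B pos by simp
  show v': "v = 2 * k + 1"
  proof (rule ccontr)
    assume "v \<noteq> 2 * k + 1"
    then have "(2::int) ^ (2 * k + 2) \<le> 2 ^ v"
      using v by (intro power_increasing) auto
    then have "4 * K * K \<le> 2 ^ v"
      by (simp add: K_def power_add power_even_eq power2_eq_square)
    then show False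
      using eq eqpos K1 by linarith
  qed
  have "(2::int) ^ v = 2 * K * K"
    by (simp add: v' K_def power_add power_even_eq power2_eq_square)
  then have eq2: "int B * (2 ^ a' - 1) = (K - 1) * (K - 4)"
    using eq by (simp add: algebra_simps)
  show k: "2 < k"
  proof (rule ccontr)
    assume "\<not> 2 < k"
    then have "K \<le> 2 ^ 2"
      unfolding K_def by (intro power_increasing) auto
    then have "(K - 1) * (K - 4) \<le> 0"
      using K1 by (simp add: mult_le_0_iff)
    then show False
      using eq2 eqpos by linarith
  qed
  have "K = 4 * 2 ^ (k - 2)"
  proof -
    obtain j where "k = j + 2"
      using k by (metis le_add_diff_inverse2 less_imp_le)
    then show ?thesis
      by (simp add: K_def power_add)
  qed
  then have "int B * (2 ^ a' - 1) = 4 * ((2 ^ k - 1) * (2 ^ (k - 2) - 1))"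
    using eq2 by (simp add: K_def[symmetric])
  then have "(2 ^ a' - 1) dvd 4 * ((2 ^ k - 1) * (2 ^ (k - 2) - 1) :: int)"
    by (metis dvd_triv_right)
  moreover have "coprime (2 ^ a' - 1) (4 :: int)"
  proof -
    have "odd (2 ^ a' - 1 :: int)" using a' by simp
    then have "coprime (2 ^ a' - 1) (2 ^ 2 :: int)" by (simp only: coprime_power_right_iff) simp
    then show ?thesis by simp
  qed
  ultimately have "(2 ^ a' - 1) dvd ((2 ^ k - 1) * (2 ^ (k - 2) - 1) :: int)"
    by (simp add: coprime_dvd_mult_right_iff)
  then have "int (2 ^ a' - 1) dvd int ((2 ^ k - 1) * (2 ^ (k - 2) - 1))"
    by (simp add: of_nat_diff)
  then show "2 ^ (a - 1) - 1 dvd (2 ^ k - 1) * (2 ^ (k - 2) - 1 :: nat)"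
    by (simp only: int_dvd_int_iff a' diff_Suc_1)
qed

text \<open>
  With \<open>m = 2 ^ (k - 2)\<close> and \<open>p = 2 ^ (d - 2)\<close> the equation becomes
  \<open>A * (p - 1) = 2 * (4 * m - 1) * (m - 1)\<close>, whereas \<open>A \<le> 2 * (4 * m - 1)\<close>.  So a nonzero \<open>A\<close> needs
  \<open>m \<le> p \<le> 2 * m\<close>, and both are powers of \<open>2\<close>.  The case \<open>p = m\<close> gives the extreme value of
  \<open>A\<close>, and \<open>p = 2 * m\<close> makes \<open>2 * m - 1\<close> a
  divisor of \<open>1\<close>.
\<close>

lemma adjacent_count_arith:
  fixes k v d A :: nat
  assumes d: "3 \<le> d" "d \<le> k + 1" and v: "2 * k + 1 \<le> v" and A: "int A \<le> 2 ^ (k + 1) - 2"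
    and count: "(2 ^ (k + 1) - 2) * (2 ^ (k + 1) - 4) - int A * (2 ^ d - 4)
      = 2 ^ v - 2 ^ (k + 1)"
  shows "A = 0 \<or> int A = 2 ^ (k + 1) - 2" "v = 2 * k + 1"
proof -
  define e where "e = d - 2"
  define j where "j = k - 2"
  have e: "d = e + 2" "1 \<le> e" and j: "k = j + 2"
    using d by (auto simp: e_def j_def)
  define m :: int where "m = 2 ^ j"
  define p :: int where "p = 2 ^ e"
  have m: "1 \<le> m" by (simp add: m_def)
  have p: "2 \<le> p" using power_increasing[of 1 e "2::int"] e(2) by (simp add: p_def)
  have pow: "(2::int) ^ (k + 1) = 8 * m" "(2::int) ^ d = 4 * p"
    by (simp_all add: m_def p_def j e(1) power_add)
  have eq: "64 * m * m - 48 * m + 8 - 4 * (int A * (p - 1)) = 2 ^ v - 8 * m"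
    using count unfolding pow by (simp add: algebra_simps)
  show v': "v = 2 * k + 1"
  proof (rule ccontr)
    assume "v \<noteq> 2 * k + 1"
    then have "(2::int) ^ (2 * k + 2) \<le> 2 ^ v"
      using v by (intro power_increasing) auto
    then have "64 * m * m \<le> 2 ^ v"
      by (simp add: m_def j power_add power_even_eq power2_eq_square)
    moreover have "0 \<le> int A * (p - 1)"
      using p by simp
    ultimately show False
      using eq m by (simp add: algebra_simps)
  qed
  have "(2::int) ^ v = 32 * m * m"
    by (simp add: v' m_def j power_add power_even_eq power2_eq_square)
  then have eq2: "int A * (p - 1) = 2 * (4 * m - 1) * (m - 1)"
    using eq by (simp add: algebra_simps)
  show "A = 0 \<or> int A = 2 ^ (k + 1) - 2"
  proof (cases "A = 0")
    case False
    have "2 * (4 * m - 1) * (m - 1) \<le> 2 * (4 * m - 1) * (p - 1)"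
      using eq2 A p mult_right_mono[of "int A" "8 * m - 2" "p - 1"] unfolding pow by simp
    then have "m \<le> p"
      using m by (simp add: mult_le_cancel_left)
    then have "j \<le> e" "e \<le> j + 1"
      using d(2) by (auto simp: m_def p_def e j)
    then consider "e = j" | "e = j + 1" by linarith
    then show ?thesis
    proof cases
      case 1
      then have "int A * (p - 1) = (8 * m - 2) * (p - 1)"
        using eq2 by (simp add: m_def p_def algebra_simps)
      then show ?thesis
        using p unfolding pow by simp
    next
      case 2
      then have pm: "p = 2 * m" by (simp add: m_def p_def)
      \<comment> \<open>With \<open>t = 2 * m - 1\<close> the equation is \<open>A * t = (2 * t + 1) * (t - 1)\<close>, so \<open>t\<close> divides \<open>1\<close>.\<close>
      have "(2 * m - 1) * ((4 * m - 3) - int A) = 1"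
        using eq2 unfolding pm by (simp add: algebra_simps)
      then have "2 * m - 1 dvd 1"
        by (metis dvd_triv_left)
      then have "m = 1"
        using m by simp
      then show ?thesis
        using eq2 False pm by simp
    qed
  qed simp
qed

section \<open>Counting points of subspaces\<close>

lemma card_span_insert:
  fixes B :: "('q::{field,finite} ^ 'n::finite) set"
  assumes "b \<notin> vec.span B"
  shows "card (vec.span (insert b B)) = CARD('q) * card (vec.span B)"
proof -
  let ?f = "\<lambda>(c, x). c *s b + x"
  have "inj_on ?f (UNIV \<times> vec.span B)"
  proof (clarsimp simp: inj_on_def, goal_cases)
    case (1 c x c' x')
    have "c = c'"
    proof (rule ccontr)
      assume "c \<noteq> c'"
      have "(c - c') *s b = x' - x"
        using 1 by (simp add: vec.scale_left_diff_distrib algebra_simps)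
      then have "(c - c') *s b \<in> vec.span B"
        using 1 by (simp add: vec.span_diff)
      then have "inverse (c - c') *s ((c - c') *s b) \<in> vec.span B"
        by (rule vec.span_scale)
      then show False
        using \<open>c \<noteq> c'\<close> assms by simp
    qed
    then show ?case
      using 1 by simp
  qed
  moreover have "?f ` (UNIV \<times> vec.span B) = vec.span (insert b B)"
  proof (intro set_eqI iffI)
    fix y assume "y \<in> ?f ` (UNIV \<times> vec.span B)"
    then show "y \<in> vec.span (insert b B)"
      using vec.span_mono[of B "insert b B"]
      by (auto intro!: vec.span_add vec.span_scale intro: vec.span_base)
  next
    fix y assume "y \<in> vec.span (insert b B)"
    then obtain c where "y - c *s b \<in> vec.span B"
      by (auto simp: vec.span_breakdown_eq)
    then show "y \<in> ?f ` (UNIV \<times> vec.span B)"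
      by (intro image_eqI[where x = "(c, y - c *s b)"]) auto
  qed
  ultimately show ?thesis
    by (metis card_cartesian_product card_image)
qed

lemma card_subspace:
  fixes U :: "('q::{field,finite} ^ 'n::finite) set"
  assumes "vec.subspace U"
  shows "card U = CARD('q) ^ vec.dim U"
proof -
  have span: "finite B \<Longrightarrow> vec.independent B \<Longrightarrow> card (vec.span B) = CARD('q) ^ card B"
    for B :: "('q ^ 'n) set"
  proof (induction B rule: finite_induct)
    case empty
    then show ?case by simp
  next
    case (insert b B)
    then show ?case
      by (simp add: card_span_insert vec.independent_insert)
  qed
  obtain B where "finite B" "vec.independent B" "vec.span B = U" "card B = vec.dim U"
    using vec.basis_subspace_exists[OF assms] by metis
  then show ?thesis
    using span by metis
qed

lemma vertex_eq_span:
  assumes "P \<in> vertices" "x \<in> P" "x \<noteq> 0"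
  shows "P = vec.span {x}"
  using assms vec.subspace_dim_equal[of "vec.span {x}" P]
  by (auto simp: subspaces_of_dim_def vec.span_minimal)

lemma span_nonzero_vertex: "x \<noteq> 0 \<Longrightarrow> vec.span {x} \<in> vertices"
  by (simp add: subspaces_of_dim_def)

definition points :: "('q::field ^ 'n::finite) set \<Rightarrow> ('q ^ 'n) set set" where
  "points U = {P \<in> vertices. P \<subseteq> U}"

lemma two_le_card_field: "2 \<le> CARD('q::{field,finite})"
proof -
  have "card {0, 1 :: 'q} \<le> CARD('q)"
    by (rule card_mono) auto
  then show ?thesis by simp
qed

text \<open>
  The nonzero vectors of \<open>U\<close> are partitioned by the points of \<open>U\<close>, each of which carries
  \<open>q - 1\<close> of them.
\<close>

lemma card_points:
  fixes U :: "('q::{field,finite} ^ 'n::finite) set"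
  assumes U: "vec.subspace U"
  shows "card (points U) = gaussian_number CARD('q) (vec.dim U)"
proof -
  have q: "2 \<le> CARD('q)" by (rule two_le_card_field)
  have "U - {0} = (\<Union>P\<in>points U. P - {0})"
  proof (intro set_eqI iffI)
    fix x assume x: "x \<in> U - {0}"
    then have "vec.span {x} \<subseteq> U"
      using U by (intro vec.span_minimal) auto
    then have "vec.span {x} \<in> points U" "x \<in> vec.span {x} - {0}"
      using x by (auto simp: points_def vec.span_base intro: span_nonzero_vertex[simplified])
    then show "x \<in> (\<Union>P\<in>points U. P - {0})"
      by blast
  qed (auto simp: points_def)
  then have "card (U - {0}) = card (\<Union>P\<in>points U. P - {0})"
    by simp
  also have "\<dots> = (\<Sum>P\<in>points U. card (P - {0}))"
  proof (rule card_UN_disjoint)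
    show "\<forall>P\<in>points U. \<forall>Q\<in>points U. P \<noteq> Q \<longrightarrow> (P - {0}) \<inter> (Q - {0}) = {}"
    proof (intro ballI impI)
      fix P Q :: "('q ^ 'n) set" assume "P \<in> points U" "Q \<in> points U" "P \<noteq> Q"
      then show "(P - {0}) \<inter> (Q - {0}) = {}"
        using vertex_eq_span unfolding points_def by blast
    qed
  qed auto
  also have "\<dots> = (\<Sum>P\<in>points U. CARD('q) - 1)"
  proof (rule sum.cong)
    fix P assume "P \<in> points U"
    then have "vec.subspace P" "vec.dim P = 1"
      by (auto simp: points_def subspaces_of_dim_def)
    then show "card (P - {0}) = CARD('q) - 1"
      using card_subspace[of P] vec.subspace_0[of P] by (simp add: card_Diff_singleton)
  qed simp
  finally have "card (points U) * (CARD('q) - 1) = CARD('q) ^ vec.dim U - 1"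
    using card_subspace[OF U] vec.subspace_0[OF U] by (simp add: card_Diff_singleton)
  moreover have "gaussian_number CARD('q) (vec.dim U) * (CARD('q) - 1) = CARD('q) ^ vec.dim U - 1"
    using gaussian_number_mult[of "CARD('q)" "vec.dim U"] by simp
  ultimately have "card (points U) * (CARD('q) - 1)
      = gaussian_number CARD('q) (vec.dim U) * (CARD('q) - 1)"
    by (simp only:)
  then show ?thesis
    using q by (simp only: mult_cancel2) linarith
qed

lemma points_Int: "points U \<inter> points W = points (U \<inter> W)"
  by (auto simp: points_def)

lemma span_Union_points:
  assumes "vec.subspace U"
  shows "vec.span (\<Union> (points U)) = U"
proof (rule vec.span_unique)
  show "\<Union> (points U) \<subseteq> U"
    by (auto simp: points_def)
  show "vec.subspace U" by fact
  fix W assume W: "\<Union> (points U) \<subseteq> W" "vec.subspace W"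
  show "U \<subseteq> W"
  proof
    fix x assume x: "x \<in> U"
    show "x \<in> W"
    proof (cases "x = 0")
      case True
      then show ?thesis using vec.subspace_0[OF W(2)] by simp
    next
      case False
      then have "vec.span {x} \<in> points U"
        using x assms span_nonzero_vertex[OF False] by (auto simp: points_def vec.span_minimal)
      then show ?thesis
        using W(1) vec.span_base[of x "{x}"] by blast
    qed
  qed
qed

lemma span_Un_vertices:
  assumes L: "L \<in> subspaces_of_dim 2" and XY: "X \<in> points L" "Y \<in> points L" "X \<noteq> Y"
  shows "vec.span (X \<union> Y) = L"
proof -
  let ?S = "vec.span (X \<union> Y)"
  have X: "vec.subspace X" "vec.dim X = 1" and Y: "vec.subspace Y" "vec.dim Y = 1"
    and LL: "vec.subspace L" "vec.dim L = 2" and sub: "X \<union> Y \<subseteq> L"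
    using assms by (auto simp: points_def subspaces_of_dim_def)
  have SL: "?S \<subseteq> L"
    using sub LL(1) by (rule vec.span_minimal)
  have XS: "X \<subseteq> ?S" "Y \<subseteq> ?S"
    using vec.span_superset[of "X \<union> Y"] by auto
  have "2 \<le> vec.dim ?S"
  proof (rule ccontr)
    assume "\<not> 2 \<le> vec.dim ?S"
    then have "X = ?S" "Y = ?S"
      using XS X Y vec.subspace_dim_equal[of X ?S] vec.subspace_dim_equal[of Y ?S]
      by (auto simp: vec.subspace_span simp del: vec.dim_span)
    then show False
      using XY(3) by blast
  qed
  then show ?thesis
    using SL LL vec.subspace_dim_equal[of ?S L] by (simp add: vec.subspace_span del: vec.dim_span)
qed

section \<open>Neighbor spaces and common neighbors\<close>

definition neighbor_space ::
  "('q::field ^ 'n::finite) set set \<Rightarrow> ('q ^ 'n) set \<Rightarrow> ('q ^ 'n) set" where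
  "neighbor_space E X = vec.span (\<Union> (neighborhood E X))"

definition common_dim ::
  "('q::field ^ 'n::finite) set set \<Rightarrow> ('q ^ 'n) set \<Rightarrow> ('q ^ 'n) set \<Rightarrow> nat" where
  "common_dim E X Y = vec.dim (neighbor_space E X \<inter> neighbor_space E Y)"

lemma adjacent_sym: "adjacent E X Y \<longleftrightarrow> adjacent E Y X"
  by (auto simp: adjacent_def Un_commute)

lemma adjacent_iff_neighborhood: "adjacent E X Y \<longleftrightarrow> Y \<in> neighborhood E X \<and> X \<noteq> Y"
  by (auto simp: neighborhood_def adjacent_def)

lemma neighborhood_sym: "Y \<in> neighborhood E X \<longleftrightarrow> X \<in> neighborhood E Y"
  using adjacent_sym by (auto simp: neighborhood_def)

lemma neighborhood_subset: "X \<in> vertices \<Longrightarrow> neighborhood E X \<subseteq> vertices"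
  by (auto simp: neighborhood_def adjacent_def)

context
  fixes E :: "('q::{field,finite} ^ 'n::finite) set set" and k :: nat
  assumes reg: "regular_qary_graph E k"
begin

lemma neighbor_space:
  assumes "X \<in> vertices"
  shows "vec.subspace (neighbor_space E X)" "vec.dim (neighbor_space E X) = k + 1"
    "neighborhood E X = points (neighbor_space E X)"
proof -
  obtain U where U: "U \<in> subspaces_of_dim (k + 1)" "neighborhood E X = points U"
    using reg assms unfolding regular_qary_graph_def points_def by blast
  then have "neighbor_space E X = U"
    by (simp add: neighbor_space_def span_Union_points subspaces_of_dim_def)
  with U show "vec.subspace (neighbor_space E X)" "vec.dim (neighbor_space E X) = k + 1"
    "neighborhood E X = points (neighbor_space E X)"
    by (auto simp: subspaces_of_dim_def)
qed

lemma card_neighborhood: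
  "X \<in> vertices \<Longrightarrow> card (neighborhood E X) = gaussian_number CARD('q) (k + 1)"
  by (metis card_points neighbor_space)

lemma card_neighborhood_Int:
  assumes "X \<in> vertices" "Y \<in> vertices"
  shows "card (neighborhood E X \<inter> neighborhood E Y) = gaussian_number CARD('q) (common_dim E X Y)"
  using assms
  by (simp add: neighbor_space points_Int card_points vec.subspace_inter common_dim_def)

lemma card_common_neighbors_adjacent:
  assumes "adjacent E X Y"
  shows "gaussian_number CARD('q) (common_dim E X Y) = card (common_neighbors E X Y) + 2"
proof -
  have XY: "X \<in> vertices" "Y \<in> vertices" "X \<noteq> Y"
    using assms by (auto simp: adjacent_def)
  have "{X, Y} \<subseteq> neighborhood E X \<inter> neighborhood E Y"
    using assms adjacent_sym by (auto simp: neighborhood_def)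
  then have "card (common_neighbors E X Y) + card {X, Y}
      = card (neighborhood E X \<inter> neighborhood E Y)"
    unfolding common_neighbors_def by (simp add: card_Diff_subset card_mono le_add_diff_inverse2)
  then show ?thesis
    using XY by (simp add: card_neighborhood_Int)
qed

lemma card_common_neighbors_nonadjacent:
  assumes "X \<in> vertices" "Y \<in> vertices" "X \<noteq> Y" "\<not> adjacent E X Y"
  shows "card (common_neighbors E X Y) = gaussian_number CARD('q) (common_dim E X Y)"
proof -
  have "common_neighbors E X Y = neighborhood E X \<inter> neighborhood E Y"
    using assms neighborhood_sym[of X E Y] by (auto simp: common_neighbors_def adjacent_iff_neighborhood)
  then show ?thesis
    using assms by (simp add: card_neighborhood_Int)
qed

lemma common_dim_le:
  assumes "X \<in> vertices" "Y \<in> vertices"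
  shows "common_dim E X Y \<le> k + 1"
  using vec.dim_subset[of "neighbor_space E X \<inter> neighbor_space E Y" "neighbor_space E X"]
    neighbor_space[OF assms(1)] by (simp add: common_dim_def)

lemma common_dim_adjacent:
  assumes "adjacent E X Y"
  shows "2 \<le> common_dim E X Y"
  using card_common_neighbors_adjacent[OF assms]
  by (cases "common_dim E X Y"; cases "common_dim E X Y - 1") auto

text \<open>
  Equality of the two neighbor spaces would put \<open>X\<close> into the neighborhood of \<open>Y\<close>.
\<close>

lemma common_dim_nonadjacent:
  assumes "X \<in> vertices" "Y \<in> vertices" "X \<noteq> Y" "\<not> adjacent E X Y"
  shows "common_dim E X Y \<le> k"
proof (rule ccontr)
  assume "\<not> common_dim E X Y \<le> k"
  then have "common_dim E X Y = k + 1"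
    using common_dim_le[OF assms(1,2)] by simp
  then have "neighborhood E X \<inter> neighborhood E Y = neighborhood E X"
    using assms by (intro card_subset_eq) (auto simp: card_neighborhood_Int card_neighborhood)
  then have "X \<in> neighborhood E Y"
    by (auto simp: neighborhood_def)
  then show False
    using assms by (simp add: adjacent_iff_neighborhood neighborhood_sym[of Y])
qed

lemma common_dim_ge:
  assumes "X \<in> vertices" "Y \<in> vertices"
  shows "2 * k + 2 \<le> common_dim E X Y + CARD('n)"
proof -
  let ?U = "neighbor_space E X" and ?W = "neighbor_space E Y"
  have "vec.dim {x + y |x y. x \<in> ?U \<and> y \<in> ?W} + vec.dim (?U \<inter> ?W) = vec.dim ?U + vec.dim ?W"
    using assms by (intro vec.dim_sums_Int neighbor_space)
  moreover have "vec.dim {x + y |x y. x \<in> ?U \<and> y \<in> ?W} \<le> CARD('n)"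
    using vec.dim_subset[OF subset_UNIV] by (simp only: vec_dim_card)
  ultimately show ?thesis
    using assms by (simp add: neighbor_space common_dim_def)
qed

lemma card_vertices: "card (vertices :: ('q ^ 'n) set set) = gaussian_number CARD('q) CARD('n)"
  using card_points[of "UNIV :: ('q ^ 'n) set"] by (simp add: points_def vec_dim_card card_cart_basis)

section \<open>Counting paths of length two and edges\<close>

text \<open>
  Both sides count the pairs \<open>(Z, Y)\<close> where \<open>Z\<close> is adjacent to \<open>X\<close>, \<open>Y\<close> is adjacent to \<open>Z\<close>, and \<open>Y\<close>
  lies outside the neighborhood of \<open>X\<close>: the left one groups them by \<open>Z\<close>, the right one by \<open>Y\<close>.
\<close>

lemma two_path_count:
  assumes X: "X \<in> vertices"
  shows "(\<Sum>Z | adjacent E X Z.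
            gaussian_number CARD('q) (k + 1) - gaussian_number CARD('q) (common_dim E X Z))
       = (\<Sum>Y \<in> vertices - neighborhood E X. card (common_neighbors E X Y))"
proof -
  have fin: "finite A" for A :: "('q ^ 'n) set set"
    by simp
  have "(\<Sum>Z | adjacent E X Z. card {Y \<in> vertices - neighborhood E X. Y \<in> neighborhood E Z})
      = (\<Sum>Y \<in> vertices - neighborhood E X. card (common_neighbors E X Y))"
  proof (rule sum_multicount_gen)
    show "\<forall>Y\<in>vertices - neighborhood E X.
        card {Z \<in> {Z. adjacent E X Z}. Y \<in> neighborhood E Z} = card (common_neighbors E X Y)"
    proof
      fix Y assume Y: "Y \<in> vertices - neighborhood E X"
      have "Z \<in> {Z. adjacent E X Z} \<and> Y \<in> neighborhood E Z \<longleftrightarrow> Z \<in> common_neighbors E X Y" for Z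
        unfolding common_neighbors_def adjacent_iff_neighborhood neighborhood_sym[of Y E Z]
        using Y by auto
      then have "{Z \<in> {Z. adjacent E X Z}. Y \<in> neighborhood E Z} = common_neighbors E X Y"
        by blast
      then show "card {Z \<in> {Z. adjacent E X Z}. Y \<in> neighborhood E Z}
          = card (common_neighbors E X Y)"
        by simp
    qed
  qed (rule fin)+
  moreover have "card {Y \<in> vertices - neighborhood E X. Y \<in> neighborhood E Z}
      = gaussian_number CARD('q) (k + 1) - gaussian_number CARD('q) (common_dim E X Z)"
    if "adjacent E X Z" for Z
  proof -
    have Z: "Z \<in> vertices"
      using that by (simp add: adjacent_def)
    have "{Y \<in> vertices - neighborhood E X. Y \<in> neighborhood E Z}
        = neighborhood E Z - (neighborhood E X \<inter> neighborhood E Z)"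
      using neighborhood_subset[OF Z, of E] by auto
    then show ?thesis
      using X Z by (simp add: card_Diff_subset card_neighborhood card_neighborhood_Int)
  qed
  ultimately show ?thesis
    by simp
qed

text \<open>
  Adjacency depends only on the line joining two points, so the ordered adjacent pairs are exactly
  the ordered pairs of distinct points on the edges, and each pair lies on one edge only.
\<close>

lemma edge_count:
  "card E * (CARD('q) * (CARD('q) + 1))
     = gaussian_number CARD('q) CARD('n) * (gaussian_number CARD('q) (k + 1) - 1)"
proof -
  let ?F = "\<lambda>L. SIGMA X : points L. points L - {X}"
  have E: "vec.subspace L \<and> vec.dim L = 2" if "L \<in> E" for L
    using that reg by (auto simp: regular_qary_graph_def qary_graph_def subspaces_of_dim_def)
  have line: "vec.span (X \<union> Y) = L" if "L \<in> E" "X \<in> points L" "Y \<in> points L" "X \<noteq> Y" for L X Y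
    using span_Un_vertices[of L X Y] that E by (auto simp: subspaces_of_dim_def)
  have "(\<Union>L\<in>E. ?F L) = (SIGMA X : vertices. {Y. adjacent E X Y})"
  proof (intro set_eqI iffI)
    fix p assume "p \<in> (\<Union>L\<in>E. ?F L)"
    then show "p \<in> (SIGMA X : vertices. {Y. adjacent E X Y})"
      using line by (fastforce simp: adjacent_def points_def)
  next
    fix p assume "p \<in> (SIGMA X : vertices. {Y. adjacent E X Y})"
    then obtain X Y where p: "p = (X, Y)" "adjacent E X Y"
      by auto
    have "X \<in> points (vec.span (X \<union> Y))" "Y \<in> points (vec.span (X \<union> Y))"
      using p(2) vec.span_superset[of "X \<union> Y"] by (auto simp: adjacent_def points_def)
    then show "p \<in> (\<Union>L\<in>E. ?F L)"
      using p by (auto simp: adjacent_def)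
  qed
  then have "card (SIGMA X : vertices. {Y. adjacent E X Y}) = card (\<Union>L\<in>E. ?F L)"
    by simp
  also have "\<dots> = (\<Sum>L\<in>E. card (?F L))"
  proof (rule card_UN_disjoint)
    show "\<forall>L\<in>E. \<forall>M\<in>E. L \<noteq> M \<longrightarrow> ?F L \<inter> ?F M = {}"
    proof (intro ballI impI Int_emptyI)
      fix L M p assume LM: "L \<in> E" "M \<in> E" "L \<noteq> M" "p \<in> ?F L" "p \<in> ?F M"
      obtain X Y where "p = (X, Y)"
        by (cases p)
      then show False
        using LM line[of L X Y] line[of M X Y] not_sym[of Y X] by simp
    qed
  qed auto
  also have "\<dots> = (\<Sum>L\<in>E. CARD('q) * (CARD('q) + 1))"
  proof (rule sum.cong)
    fix L assume "L \<in> E"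
    then have "card (points L) = CARD('q) + 1"
      using E[of L] by (simp add: card_points numeral_2_eq_2 gaussian_number_Suc)
    then show "card (?F L) = CARD('q) * (CARD('q) + 1)"
      by (simp add: card_Diff_singleton)
  qed simp
  finally have "card E * (CARD('q) * (CARD('q) + 1))
      = card (SIGMA X : vertices. {Y. adjacent E X Y})"
    by simp
  also have "\<dots> = (\<Sum>X \<in> (vertices :: ('q ^ 'n) set set). card {Y. adjacent E X Y})"
    by (rule card_SigmaI) auto
  also have "\<dots> = (\<Sum>X \<in> (vertices :: ('q ^ 'n) set set). gaussian_number CARD('q) (k + 1) - 1)"
  proof (rule sum.cong)
    fix X :: "('q ^ 'n) set" assume X: "X \<in> vertices"
    have "{Y. adjacent E X Y} = neighborhood E X - {X}" "X \<in> neighborhood E X"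
      by (auto simp: neighborhood_def adjacent_def)
    then show "card {Y. adjacent E X Y} = gaussian_number CARD('q) (k + 1) - 1"
      using X by (simp add: card_neighborhood)
  qed simp
  finally show ?thesis
    unfolding sum_constant card_vertices of_nat_id .
qed

end

section \<open>Graphs over the field with two elements\<close>

context
  fixes E :: "('q::{field,finite} ^ 'n::finite) set set" and k :: nat
  assumes reg: "regular_qary_graph E k" and binary: "CARD('q) = 2"
begin

lemma card_adjacent:
  assumes "X \<in> vertices"
  shows "int (card {Z. adjacent E X Z}) = 2 ^ (k + 1) - 2"
proof -
  have "{Z. adjacent E X Z} = neighborhood E X - {X}" "X \<in> neighborhood E X"
    by (auto simp: neighborhood_def adjacent_def)
  then have "card {Z. adjacent E X Z} = (2 ^ (k + 1) - 1) - 1"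
    using card_neighborhood[OF reg assms] by (simp add: binary gaussian_number_binary)
  moreover have "2 \<le> (2::nat) ^ (k + 1)"
    by simp
  ultimately have "card {Z. adjacent E X Z} + 2 = 2 ^ (k + 1)"
    by linarith
  then have "int (card {Z. adjacent E X Z} + 2) = int (2 ^ (k + 1))"
    by (simp only:)
  then show ?thesis
    by simp
qed

lemma card_nonneighbors:
  assumes X: "X \<in> vertices"
  shows "int (card (vertices - neighborhood E X)) = 2 ^ CARD('n) - 2 ^ (k + 1)"
proof -
  have "int (card (vertices - neighborhood E X))
      = int (card (vertices :: ('q ^ 'n) set set)) - int (card (neighborhood E X))"
    using neighborhood_subset[OF X] by (simp add: card_Diff_subset card_mono of_nat_diff)
  then show ?thesis
    unfolding card_vertices[OF reg] card_neighborhood[OF reg X] binary gaussian_number_binary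
    by (simp add: of_nat_diff)
qed

text \<open>
  A predicate \<open>P\<close> selects the neighbors with an exceptional intersection dimension \<open>d\<close>; the
  right-hand side is the count for intersections in lines throughout, corrected for these neighbors.
\<close>

lemma two_path_count_binary:
  assumes X: "X \<in> vertices"
    and dims: "\<And>Z. adjacent E X Z \<Longrightarrow> common_dim E X Z = (if P Z then d else 2)"
  shows "int (\<Sum>Y \<in> vertices - neighborhood E X. card (common_neighbors E X Y))
    = (2 ^ (k + 1) - 2) * (2 ^ (k + 1) - 4)
      - int (card {Z. adjacent E X Z \<and> P Z}) * (2 ^ d - 4)"
proof -
  let ?f = "\<lambda>Z. int (gaussian_number CARD('q) (k + 1) - gaussian_number CARD('q) (common_dim E X Z))"
  have "?f Z = (if P Z then 2 ^ (k + 1) - 2 ^ d else 2 ^ (k + 1) - 4)"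
    if Z: "Z \<in> {Z. adjacent E X Z}" for Z
  proof -
    have "Z \<in> vertices"
      using Z by (simp add: adjacent_def)
    then have "gaussian_number CARD('q) (common_dim E X Z) \<le> gaussian_number CARD('q) (k + 1)"
      using common_dim_le[OF reg X] by (intro gaussian_number_mono) (auto simp: binary)
    then have "?f Z = int (gaussian_number 2 (k + 1)) - int (gaussian_number 2 (common_dim E X Z))"
      by (simp add: binary of_nat_diff)
    then show ?thesis
      using dims[of Z] Z by (simp add: gaussian_number_binary of_nat_diff)
  qed
  then have "(\<Sum>Z | adjacent E X Z. ?f Z)
      = int (card {Z. adjacent E X Z}) * (2 ^ (k + 1) - 4)
        + int (card {Z \<in> {Z. adjacent E X Z}. P Z}) * ((2 ^ (k + 1) - 2 ^ d) - (2 ^ (k + 1) - 4))"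
    by (intro sum_two_valued) simp_all
  then show ?thesis
    unfolding two_path_count[OF reg X, symmetric] card_adjacent[OF X] of_nat_sum
    by (simp add: algebra_simps)
qed

text \<open>
  By the edge count, \<open>3 = 2 ^ 2 - 1\<close> divides \<open>(2 ^ v - 1) * (2 ^ k - 1)\<close>.
\<close>

lemma even_dim_mult_degree: "even (CARD('n) * k)"
proof -
  have "card E * 6 = (2 ^ CARD('n) - 1) * (2 ^ (k + 1) - 1 - 1)"
    using edge_count[OF reg] by (simp add: binary gaussian_number_binary)
  moreover have "(2::nat) ^ (k + 1) - 1 - 1 = 2 * (2 ^ k - 1)"
    by (simp add: algebra_simps)
  ultimately have "card E * 3 = (2 ^ CARD('n) - 1) * (2 ^ k - 1)"
    by (simp add: mult_ac)
  then have "2 ^ 2 - 1 dvd (2 ^ CARD('n) - 1) * (2 ^ k - 1 :: nat)"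
    by (intro dvdI[of _ _ "card E"]) simp
  then show ?thesis
    using dvd_exponent_of_Mersenne_dvd_mult[of 2] by auto
qed

text \<open>
  The path count determines the number \<open>A X\<close> of neighbors with intersection dimension \<open>d\<close>
  independently of \<open>X\<close>.  By \<open>adjacent_count_arith\<close> it is zero or the full degree, but \<open>X\<close> shows that
  it is not zero, and \<open>X'\<close> that it is not full.
\<close>

lemma not_two_adjacent_values:
  assumes d: "3 \<le> d"
    and adj: "\<And>X Y. adjacent E X Y \<Longrightarrow> common_dim E X Y = d \<or> common_dim E X Y = 2"
    and nonadj: "\<And>X Y. X \<in> vertices \<Longrightarrow> Y \<in> vertices \<Longrightarrow> X \<noteq> Y \<Longrightarrow> \<not> adjacent E X Y
        \<Longrightarrow> card (common_neighbors E X Y) = 1"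
    and XY: "adjacent E X Y" "common_dim E X Y = d"
    and XY': "adjacent E X' Y'" "common_dim E X' Y' = 2"
    and PQ: "P \<in> vertices" "Q \<in> vertices" "P \<noteq> Q" "\<not> adjacent E P Q"
  shows False
proof -
  define A where "A X = card {Z. adjacent E X Z \<and> common_dim E X Z = d}" for X
  have vert: "X \<in> vertices" "Y \<in> vertices" "X' \<in> vertices"
    using XY XY' by (auto simp: adjacent_def)
  have dk: "d \<le> k + 1"
    using common_dim_le[OF reg vert(1,2)] XY by simp
  have "gaussian_number 2 (common_dim E P Q) = gaussian_number 2 1"
    using nonadj[OF PQ] card_common_neighbors_nonadjacent[OF reg PQ] by (simp add: binary)
  then have "common_dim E P Q = 1"
    by (subst (asm) gaussian_number_inject) auto
  then have v: "2 * k + 1 \<le> CARD('n)"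
    using common_dim_ge[OF reg PQ(1,2)] by simp
  have count: "(2 ^ (k + 1) - 2) * (2 ^ (k + 1) - 4) - int (A X) * (2 ^ d - 4)
      = 2 ^ CARD('n) - 2 ^ (k + 1)" if X: "X \<in> vertices" for X
  proof -
    have "(\<Sum>Y \<in> vertices - neighborhood E X. card (common_neighbors E X Y))
        = (\<Sum>Y \<in> vertices - neighborhood E X. 1)"
      using X by (intro sum.cong nonadj refl) (auto simp: neighborhood_def)
    then have "int (\<Sum>Y \<in> vertices - neighborhood E X. card (common_neighbors E X Y))
        = 2 ^ CARD('n) - 2 ^ (k + 1)"
      using card_nonneighbors[OF X] by simp
    then show ?thesis
      using two_path_count_binary[OF X, of "\<lambda>Z. common_dim E X Z = d" d] adj
      unfolding A_def by fastforce
  qed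
  have le: "int (A X) \<le> 2 ^ (k + 1) - 2" if "X \<in> vertices" for X
  proof -
    have "A X \<le> card {Z. adjacent E X Z}"
      unfolding A_def by (rule card_mono) auto
    then show ?thesis
      using card_adjacent[OF that] by linarith
  qed
  have "Y \<in> {Z. adjacent E X Z \<and> common_dim E X Z = d}"
    using XY by simp
  then have "A X \<noteq> 0"
    unfolding A_def by auto
  then have full: "int (A X) = 2 ^ (k + 1) - 2"
    using adjacent_count_arith(1)[OF d dk v le[OF vert(1)] count[OF vert(1)]] by simp
  have "int (A X) * (2 ^ d - 4) = int (A X') * (2 ^ d - 4)"
    using count[OF vert(1)] count[OF vert(3)] by linarith
  moreover have "(2::int) ^ d - 4 \<noteq> 0"
    using power_increasing[OF d, of "2::int"] by simp
  ultimately have "A X' = A X"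
    by simp
  moreover have "A X' < card {Z. adjacent E X' Z}"
  proof -
    have "Y' \<in> {Z. adjacent E X' Z} - {Z. adjacent E X' Z \<and> common_dim E X' Z = d}"
      using XY' d by simp
    then have "{Z. adjacent E X' Z \<and> common_dim E X' Z = d} \<subset> {Z. adjacent E X' Z}"
      by blast
    then show ?thesis
      unfolding A_def by (intro psubset_card_mono) auto
  qed
  ultimately show False
    using full card_adjacent[OF vert(3)] by linarith
qed

text \<open>
  The pair \<open>X\<close>, \<open>Y\<close> with many common neighbors makes the path count at \<open>X\<close> nontrivial and bounds the
  exponent \<open>a\<close>; the pair \<open>X'\<close>, \<open>Y'\<close> with few common neighbors bounds \<open>v\<close> from below, since its
  neighbor spaces together span a large space.
\<close>

lemma two_nonadjacent_values:
  assumes vals: "\<And>X Y. X \<in> vertices \<Longrightarrow> Y \<in> vertices \<Longrightarrow> X \<noteq> Y \<Longrightarrow> \<not> adjacent E X Y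
        \<Longrightarrow> card (common_neighbors E X Y) \<in> {l1, l2}"
    and less: "l2 < l1" and one: "l1 = 1 \<or> l2 = 1"
    and adj: "\<And>X Y. adjacent E X Y \<Longrightarrow> common_dim E X Y = 2"
    and XY: "X \<in> vertices" "Y \<in> vertices" "X \<noteq> Y" "\<not> adjacent E X Y"
      "card (common_neighbors E X Y) = l1"
    and XY': "X' \<in> vertices" "Y' \<in> vertices" "X' \<noteq> Y'" "\<not> adjacent E X' Y'"
      "card (common_neighbors E X' Y') = l2"
  shows "deza_params_mu1 CARD('n) k l1 l2 2 \<or> deza_params_mu0 CARD('n) k l1 l2 2"
proof -
  define S where "S = vertices - neighborhood E X"
  have YS: "Y \<in> S"
    using XY by (auto simp: S_def neighborhood_def)
  have count: "int (\<Sum>Y \<in> S. card (common_neighbors E X Y))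
      = (2 ^ (k + 1) - 2) * (2 ^ (k + 1) - 4)"
    using two_path_count_binary[OF XY(1), of "\<lambda>_. False" 0] adj by (simp add: S_def)
  have g1: "gaussian_number 2 (common_dim E X Y) = l1"
    and g2: "gaussian_number 2 (common_dim E X' Y') = l2"
    using card_common_neighbors_nonadjacent[OF reg XY(1-4)]
      card_common_neighbors_nonadjacent[OF reg XY'(1-4)] XY XY' by (simp_all add: binary)
  show ?thesis
  proof (cases "l1 = 1")
    case True
    then have l2: "l2 = 0"
      using less by simp
    then have "gaussian_number 2 (common_dim E X' Y') = gaussian_number 2 0"
      using g2 by simp
    then have "common_dim E X' Y' = 0"
      by (subst (asm) gaussian_number_inject) auto
    then have v: "2 * k + 2 \<le> CARD('n)"
      using common_dim_ge[OF reg XY'(1,2)] by simp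
    \<comment> \<open>For \<open>k \<le> 1\<close> there are no paths to nonadjacent vertices at all, contrary to \<open>l1 = 1\<close>.\<close>
    have "2 \<le> k"
    proof (rule ccontr)
      assume "\<not> 2 \<le> k"
      then have "k = 0 \<or> k = 1"
        by linarith
      then have "(\<Sum>Y \<in> S. card (common_neighbors E X Y)) = 0"
        using count by (auto simp del: of_nat_sum)
      then have "card (common_neighbors E X Y) = 0"
        using YS by simp
      then show False
        using XY(5) True by simp
    qed
    then show ?thesis
      using True l2 v even_dim_mult_degree by (simp add: deza_params_mu0_def)
  next
    case False
    then have l2: "l2 = 1"
      using one by simp
    define a where "a = common_dim E X Y"
    have l1: "l1 = 2 ^ a - 1"
      using g1 by (simp add: a_def gaussian_number_binary)
    have a2: "2 \<le> a"
    proof (rule ccontr)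
      assume "\<not> 2 \<le> a"
      then have "a = 0 \<or> a = 1"
        by linarith
      then show False
        using l1 l2 less by auto
    qed
    have ak: "a \<le> k"
      using common_dim_nonadjacent[OF reg XY(1-4)] by (simp add: a_def)
    have "gaussian_number 2 (common_dim E X' Y') = gaussian_number 2 1"
      using g2 l2 by simp
    then have "common_dim E X' Y' = 1"
      by (subst (asm) gaussian_number_inject) auto
    then have v: "2 * k + 1 \<le> CARD('n)"
      using common_dim_ge[OF reg XY'(1,2)] by simp
    define B where "B = card {Z \<in> S. card (common_neighbors E X Z) = l1}"
    have "Y \<in> {Z \<in> S. card (common_neighbors E X Z) = l1}"
      using YS XY by simp
    then have B: "0 < B"
      unfolding B_def by (intro card_gt_0_iff[THEN iffD2]) auto
    have "(\<Sum>Y\<in>S. int (card (common_neighbors E X Y)))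
        = int (card S) * 1 + int (card {Z \<in> S. card (common_neighbors E X Z) = l1}) * (int l1 - 1)"
    proof (rule sum_two_valued)
      fix Z assume "Z \<in> S"
      then show "int (card (common_neighbors E X Z))
          = (if card (common_neighbors E X Z) = l1 then int l1 else 1)"
        using vals[of X Z] XY(1) l2 by (auto simp: S_def neighborhood_def)
    qed simp
    moreover have "int l1 - 1 = 2 ^ a - 2"
      by (simp add: l1 of_nat_diff)
    ultimately have "(2 ^ (k + 1) - 2) * (2 ^ (k + 1) - 4)
        = (2 ^ CARD('n) - 2 ^ (k + 1)) + int B * (2 ^ a - 2)"
      using count card_nonneighbors[OF XY(1)] by (simp add: S_def B_def)
    note arith = nonadjacent_count_arith[OF a2 B v this]
    have "a - 1 dvd k \<or> a - 1 dvd k - 2"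
      using a2 arith(3) by (intro dvd_exponent_of_Mersenne_dvd_mult) auto
    \<comment> \<open>The divisibility condition itself excludes this value, as \<open>k > 2\<close>.\<close>
    moreover have "a \<noteq> k"
    proof
      assume "a = k"
      then have "k - 1 dvd k \<or> k - 1 dvd k - 2"
        using calculation by simp
      then show False
      proof
        assume "k - 1 dvd k"
        then have "k - 1 dvd k - (k - 1)"
          by (rule dvd_diff_nat) simp
        then show False
          using arith(2) by simp
      next
        assume "k - 1 dvd k - 2"
        then show False
          using arith(2) by (auto dest: dvd_imp_le)
      qed
    qed
    moreover have "even k"
      using even_dim_mult_degree arith(1) by simp
    ultimately show ?thesis
      using arith(1) a2 ak l1 l2 unfolding deza_params_mu1_def by auto
  qed
qed

end

section \<open>The classification\<close>

lemma strongly_regularI: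
  assumes "regular_qary_graph E k"
    and adj: "\<And>X Y X' Y'. adjacent E X Y \<Longrightarrow> adjacent E X' Y'
      \<Longrightarrow> card (common_neighbors E X Y) = card (common_neighbors E X' Y')"
    and nonadj: "\<And>X Y X' Y'. X \<in> vertices \<Longrightarrow> Y \<in> vertices \<Longrightarrow> X \<noteq> Y \<Longrightarrow> \<not> adjacent E X Y
      \<Longrightarrow> X' \<in> vertices \<Longrightarrow> Y' \<in> vertices \<Longrightarrow> X' \<noteq> Y' \<Longrightarrow> \<not> adjacent E X' Y'
      \<Longrightarrow> card (common_neighbors E X Y) = card (common_neighbors E X' Y')"
  shows "strongly_regular_qary_graph E"
proof -
  obtain l where "\<And>X Y. adjacent E X Y \<Longrightarrow> card (common_neighbors E X Y) = l"
    using adj by blast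
  moreover obtain m where "\<And>X Y. X \<in> vertices \<Longrightarrow> Y \<in> vertices \<Longrightarrow> X \<noteq> Y \<Longrightarrow> \<not> adjacent E X Y
      \<Longrightarrow> card (common_neighbors E X Y) = m"
    using nonadj by metis
  ultimately show ?thesis
    unfolding strongly_regular_qary_graph_def using assms(1) by metis
qed

text \<open>
  This transfers \<open>gaussian_number_differ_by_two\<close> to graphs.  It is the only source of the restriction
  to the field with two elements.
\<close>

lemma adjacent_nonadjacent_coincidence:
  fixes E :: "('q::{field,finite} ^ 'n::finite) set set"
  assumes reg: "regular_qary_graph E k"
    and XY: "adjacent E X Y"
    and PQ: "P \<in> vertices" "Q \<in> vertices" "P \<noteq> Q" "\<not> adjacent E P Q"
    and eq: "card (common_neighbors E X Y) = card (common_neighbors E P Q)"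
  shows "CARD('q) = 2" "common_dim E X Y = 2" "card (common_neighbors E P Q) = 1"
proof -
  have "gaussian_number CARD('q) (common_dim E X Y)
      = gaussian_number CARD('q) (common_dim E P Q) + 2"
    using card_common_neighbors_adjacent[OF reg XY] card_common_neighbors_nonadjacent[OF reg PQ] eq
    by simp
  then have "CARD('q) = 2 \<and> common_dim E X Y = 2 \<and> common_dim E P Q = 1"
    using two_le_card_field by (intro gaussian_number_differ_by_two)
  then show "CARD('q) = 2" "common_dim E X Y = 2" "card (common_neighbors E P Q) = 1"
    using card_common_neighbors_nonadjacent[OF reg PQ] by simp_all
qed

text \<open>
  Failure of strong regularity makes the common neighbor number nonconstant on the adjacent or on the
  nonadjacent pairs.  A pair of the other kind takes one of the two values, and the coincidence lemma
  applies to it.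
\<close>

lemma deza_classification:
  fixes E :: "('q::{field,finite} ^ 'n::finite) set set"
  assumes deza: "q_deza_graph E v k l1 l2 q" and nsr: "\<not> strongly_regular_qary_graph E"
  shows "deza_params_mu1 v k l1 l2 q \<or> deza_params_mu0 v k l1 l2 q"
proof -
  have v: "v = CARD('n)" and q: "q = CARD('q)" and le: "l2 \<le> l1"
    and reg: "regular_qary_graph E k"
    and vals: "\<And>X Y. X \<in> vertices \<Longrightarrow> Y \<in> vertices \<Longrightarrow> X \<noteq> Y
      \<Longrightarrow> card (common_neighbors E X Y) = l1 \<or> card (common_neighbors E X Y) = l2"
    using deza unfolding q_deza_graph_def by auto
  have adj_vals: "card (common_neighbors E X Y) = l1 \<or> card (common_neighbors E X Y) = l2"
    if "adjacent E X Y" for X Y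
    using that vals by (simp add: adjacent_def)
  have less: "l2 < l1"
  proof (rule ccontr)
    assume "\<not> l2 < l1"
    then have "l1 = l2"
      using le by simp
    then have "strongly_regular_qary_graph E"
      using vals adj_vals by (intro strongly_regularI[OF reg]) metis+
    then show False
      using nsr by simp
  qed
  show ?thesis
  proof (cases "\<exists>X Y X' Y'. adjacent E X Y \<and> adjacent E X' Y'
      \<and> card (common_neighbors E X Y) = l1 \<and> card (common_neighbors E X' Y') = l2")
    case True
    then obtain X Y X' Y' where XY: "adjacent E X Y" "card (common_neighbors E X Y) = l1"
      and XY': "adjacent E X' Y'" "card (common_neighbors E X' Y') = l2"
      by blast
    \<comment> \<open>In a complete graph all neighbor spaces are the whole space, and adjacent pairs take one value.\<close>
    have "\<exists>P Q. P \<in> vertices \<and> Q \<in> vertices \<and> P \<noteq> Q \<and> \<not> adjacent E P Q"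
    proof (rule ccontr)
      assume "\<not> ?thesis"
      then have all: "neighborhood E P = vertices" if "P \<in> vertices" for P
        using that by (auto simp: neighborhood_def adjacent_def)
      have "gaussian_number CARD('q) (common_dim E P Q) = card (vertices :: ('q ^ 'n) set set)"
        if "P \<in> vertices" "Q \<in> vertices" for P Q
        using card_neighborhood_Int[OF reg that] all that by simp
      then show False
        using card_common_neighbors_adjacent[OF reg XY(1)]
          card_common_neighbors_adjacent[OF reg XY'(1)] XY XY' less
        by (simp add: adjacent_def)
    qed
    then obtain P Q where PQ: "P \<in> vertices" "Q \<in> vertices" "P \<noteq> Q" "\<not> adjacent E P Q"
      by blast
    have dims: "common_dim E X' Y' < common_dim E X Y"
    proof (rule ccontr)
      assume "\<not> ?thesis"
      then have "gaussian_number CARD('q) (common_dim E X Y)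
          \<le> gaussian_number CARD('q) (common_dim E X' Y')"
        by (intro gaussian_number_mono) auto
      then show False
        using card_common_neighbors_adjacent[OF reg XY(1)]
          card_common_neighbors_adjacent[OF reg XY'(1)] XY XY' less by simp
    qed
    have two: "2 \<le> common_dim E X' Y'"
      using common_dim_adjacent[OF reg XY'(1)] .
    have nonadj: "card (common_neighbors E P Q) = 1 \<and> CARD('q) = 2 \<and> common_dim E X' Y' = 2"
      if PQ: "P \<in> vertices" "Q \<in> vertices" "P \<noteq> Q" "\<not> adjacent E P Q" for P Q
    proof (cases "card (common_neighbors E P Q) = l1")
      case True
      then have "common_dim E X Y = 2"
        using adjacent_nonadjacent_coincidence(2)[OF reg XY(1) PQ] XY by simp
      then show ?thesis
        using dims two by simp
    next
      case False
      then have "card (common_neighbors E X' Y') = card (common_neighbors E P Q)"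
        using vals PQ XY' by metis
      then show ?thesis
        using adjacent_nonadjacent_coincidence[OF reg XY'(1) PQ] by blast
    qed
    have q2: "CARD('q) = 2" and d2: "common_dim E X' Y' = 2"
      using nonadj[OF PQ] by auto
    have "common_dim E U W = common_dim E X Y \<or> common_dim E U W = 2"
      if UW: "adjacent E U W" for U W
    proof -
      have "gaussian_number CARD('q) (common_dim E U W) = gaussian_number CARD('q) (common_dim E X Y)
        \<or> gaussian_number CARD('q) (common_dim E U W) = gaussian_number CARD('q) (common_dim E X' Y')"
        using adj_vals[OF UW] card_common_neighbors_adjacent[OF reg UW]
          card_common_neighbors_adjacent[OF reg XY(1)] card_common_neighbors_adjacent[OF reg XY'(1)]
          XY XY' by auto
      then show ?thesis
        using d2 by (simp add: gaussian_number_inject)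
    qed
    then have False
      using not_two_adjacent_values[OF reg q2, of "common_dim E X Y"] nonadj XY XY' PQ dims d2
      by (metis One_nat_def Suc_leI numeral_2_eq_2 numeral_3_eq_3)
    then show ?thesis ..
  next
    case False
    then have const: "card (common_neighbors E X Y) = card (common_neighbors E X' Y')"
      if "adjacent E X Y" "adjacent E X' Y'" for X Y X' Y'
      using that adj_vals by metis
    have "\<not> (\<forall>X Y X' Y'. X \<in> vertices \<longrightarrow> Y \<in> vertices \<longrightarrow> X \<noteq> Y \<longrightarrow> \<not> adjacent E X Y
      \<longrightarrow> X' \<in> vertices \<longrightarrow> Y' \<in> vertices \<longrightarrow> X' \<noteq> Y' \<longrightarrow> \<not> adjacent E X' Y'
      \<longrightarrow> card (common_neighbors E X Y) = card (common_neighbors E X' Y'))"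
      using strongly_regularI[OF reg const] nsr by blast
    then obtain X Y X' Y' where
      XY: "X \<in> vertices" "Y \<in> vertices" "X \<noteq> Y" "\<not> adjacent E X Y"
        "card (common_neighbors E X Y) = l1"
      and XY': "X' \<in> vertices" "Y' \<in> vertices" "X' \<noteq> Y'" "\<not> adjacent E X' Y'"
        "card (common_neighbors E X' Y') = l2"
      using vals by metis
    have adj: "CARD('q) = 2 \<and> common_dim E U W = 2 \<and> (l1 = 1 \<or> l2 = 1)"
      if UW: "adjacent E U W" for U W
      using adj_vals[OF UW] adjacent_nonadjacent_coincidence[OF reg UW XY(1-4)]
        adjacent_nonadjacent_coincidence[OF reg UW XY'(1-4)] XY(5) XY'(5) by auto
    \<comment> \<open>The larger value is positive, so adjacent pairs exist and fix the field.\<close>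
    have "common_neighbors E X Y \<noteq> {}"
      using XY(5) less by auto
    then obtain Z where "adjacent E X Z"
      by (auto simp: common_neighbors_def neighborhood_def)
    then have q2: "CARD('q) = 2" and one: "l1 = 1 \<or> l2 = 1"
      using adj by auto
    show ?thesis
      unfolding v q q2
      by (rule two_nonadjacent_values[OF reg q2 _ less one _ XY XY']) (use vals adj in auto)
  qed
qed

text \<open>
  In both families the parameters are themselves of the form \<open>2 ^ e - 1\<close>, so this is again the
  equation \<open>[d] = [e] + 2\<close>, which forces \<open>e = 1\<close>.
\<close>

lemma adjacent_one_common_neighbor:
  fixes E :: "('q::{field,finite} ^ 'n::finite) set set"
  assumes deza: "q_deza_graph E v k l1 l2 q"
    and params: "deza_params_mu1 v k l1 l2 q \<or> deza_params_mu0 v k l1 l2 q"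
    and XY: "adjacent E X Y"
  shows "card (common_neighbors E X Y) = 1"
proof (rule ccontr)
  assume not: "card (common_neighbors E X Y) \<noteq> 1"
  have reg: "regular_qary_graph E k" and q: "q = CARD('q)"
    and vals: "card (common_neighbors E X Y) \<in> {l1, l2}"
    using deza XY by (auto simp: q_deza_graph_def adjacent_def)
  have "q = 2" and "\<exists>e. e \<noteq> 1 \<and> card (common_neighbors E X Y) = gaussian_number 2 e"
  proof -
    show "q = 2"
      using params by (auto simp: deza_params_mu1_def deza_params_mu0_def)
    show "\<exists>e. e \<noteq> 1 \<and> card (common_neighbors E X Y) = gaussian_number 2 e"
      using params
    proof
      assume "deza_params_mu1 v k l1 l2 q"
      then obtain a where "2 \<le> a" "l1 = 2 ^ a - 1" "l2 = 1"
        by (auto simp: deza_params_mu1_def)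
      then show ?thesis
        using vals not by (intro exI[of _ a]) (auto simp: gaussian_number_binary)
    next
      assume "deza_params_mu0 v k l1 l2 q"
      then show ?thesis
        using vals not by (intro exI[of _ 0]) (auto simp: deza_params_mu0_def)
    qed
  qed
  then show False
    using card_common_neighbors_adjacent[OF reg XY] gaussian_number_differ_by_two[of 2] q by auto
qed

theorem theorem3p9:
  fixes E :: "('q::{field,finite} ^ 'n::finite) set set"
    and v k l1 l2 q :: nat
  assumes "q_deza_graph E v k l1 l2 q"
  shows "(strongly_regular_qary_graph E
            \<or> deza_params_mu1 v k l1 l2 q
            \<or> deza_params_mu0 v k l1 l2 q)
       \<and> (deza_params_mu1 v k l1 l2 q \<or> deza_params_mu0 v k l1 l2 q \<longrightarrow>
            (\<forall>X Y. adjacent E X Y \<longrightarrow> card (common_neighbors E X Y) = 1))"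
  using deza_classification[OF assms] adjacent_one_common_neighbor[OF assms] by blast

end
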